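(* Every non-pure biquaternion divisor of zero $p\in\mathbb{B}$ is of the form $p=\alpha q$, where $\alpha\in\mathbb{C}$, $\alpha\neq 0$, and $q$ is a biquaternion idempotent of the form $q=\frac12\pm\frac12\xi I$ for some $\xi\in\mathbb{B}$ with $\xi^2=-1$.
   Context: $\mathbb{B}$ denotes the algebra of biquaternions (quaternions with complex coefficients), whose elements are $q=W+X\boldsymbol{i}+Y\boldsymbol{j}+Z\boldsymbol{k}$ with $W,X,Y,Z\in\mathbb{C}$, where $\boldsymbol{i},\boldsymbol{j},\boldsymbol{k}$ are the usual quaternion units. The square root of $-1$ in $\mathbb{C}$ is denoted $I$; it is distinct from $\boldsymbol{i}$ and commutes with all biquaternions. $W$ is the scalar part of $q$; $q$ is pure if $W=0$ and non-pure if $W\ne 0$. The semi-norm is $\|q\|=W^2+X^2+Y^2+Z^2\in\mathbb{C}$ (no square root, no complex conjugation). A divisor of zero is a non-zero biquaternion $q$ with $\|q\|=0$. An idempotent is an element $q$ with $q^2=q$. *)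

theory Defs
  imports Complex_Main
begin

text \<open>
  The scalar complex unit, written \<open>I\<close> in the source, is \<^term>\<open>\<i>\<close>; it is unrelated to the
  quaternion units \<open>biquat_i\<close>, \<open>biquat_j\<close>, \<open>biquat_k\<close> below.
\<close>

datatype biquat =
  Biquat (scalar_part: complex) (i_part: complex) (j_part: complex) (k_part: complex)

instantiation biquat :: ring_1
begin

definition zero_biquat :: biquat where
  "0 = Biquat 0 0 0 0"

definition one_biquat :: biquat where
  "1 = Biquat 1 0 0 0"

definition plus_biquat :: "biquat \<Rightarrow> biquat \<Rightarrow> biquat" where
  "p + q = Biquat (scalar_part p + scalar_part q) (i_part p + i_part q)
                  (j_part p + j_part q) (k_part p + k_part q)"

definition uminus_biquat :: "biquat \<Rightarrow> biquat" where
  "- q = Biquat (- scalar_part q) (- i_part q) (- j_part q) (- k_part q)"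

definition minus_biquat :: "biquat \<Rightarrow> biquat \<Rightarrow> biquat" where
  "p - q = Biquat (scalar_part p - scalar_part q) (i_part p - i_part q)
                  (j_part p - j_part q) (k_part p - k_part q)"

definition times_biquat :: "biquat \<Rightarrow> biquat \<Rightarrow> biquat" where
  "p * q = Biquat
     (scalar_part p * scalar_part q - i_part p * i_part q - j_part p * j_part q - k_part p * k_part q)
     (scalar_part p * i_part q + i_part p * scalar_part q + j_part p * k_part q - k_part p * j_part q)
     (scalar_part p * j_part q - i_part p * k_part q + j_part p * scalar_part q + k_part p * i_part q)
     (scalar_part p * k_part q + i_part p * j_part q - j_part p * i_part q + k_part p * scalar_part q)"

instance
  by standard
    (simp_all add: zero_biquat_def one_biquat_def plus_biquat_def uminus_biquat_def
      minus_biquat_def times_biquat_def algebra_simps)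

end

definition biquat_of_complex :: "complex \<Rightarrow> biquat" where
  "biquat_of_complex c = Biquat c 0 0 0"

definition biquat_i :: biquat where
  "biquat_i = Biquat 0 1 0 0"

definition biquat_j :: biquat where
  "biquat_j = Biquat 0 0 1 0"

definition biquat_k :: biquat where
  "biquat_k = Biquat 0 0 0 1"

lemma biquat_eq_combination:
  "Biquat W X Y Z = biquat_of_complex W + biquat_of_complex X * biquat_i
     + biquat_of_complex Y * biquat_j + biquat_of_complex Z * biquat_k"
  by (simp add: biquat_of_complex_def biquat_i_def biquat_j_def biquat_k_def
      plus_biquat_def times_biquat_def)

lemma biquat_units:
  "biquat_i * biquat_i = - 1" "biquat_j * biquat_j = - 1" "biquat_k * biquat_k = - 1"
  "biquat_i * biquat_j = biquat_k" "biquat_j * biquat_i = - biquat_k"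
  "biquat_j * biquat_k = biquat_i" "biquat_k * biquat_j = - biquat_i"
  "biquat_k * biquat_i = biquat_j" "biquat_i * biquat_k = - biquat_j"
  by (simp_all add: biquat_i_def biquat_j_def biquat_k_def one_biquat_def uminus_biquat_def
      times_biquat_def)

lemma biquat_of_complex_commute:
  "biquat_of_complex c * q = q * biquat_of_complex c"
  by (simp add: biquat_of_complex_def times_biquat_def algebra_simps)

lemma biquat_of_complex_hom:
  "biquat_of_complex 0 = 0" "biquat_of_complex 1 = 1"
  "biquat_of_complex (c + d) = biquat_of_complex c + biquat_of_complex d"
  "biquat_of_complex (c * d) = biquat_of_complex c * biquat_of_complex d"
  by (simp_all add: biquat_of_complex_def zero_biquat_def one_biquat_def plus_biquat_def
      times_biquat_def)

definition pure :: "biquat \<Rightarrow> bool" where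
  "pure q \<longleftrightarrow> scalar_part q = 0"

text \<open>No square root and no complex conjugation: the semi-norm is complex-valued.\<close>

definition semi_norm :: "biquat \<Rightarrow> complex" where
  "semi_norm q = (scalar_part q)\<^sup>2 + (i_part q)\<^sup>2 + (j_part q)\<^sup>2 + (k_part q)\<^sup>2"

definition divisor_of_zero :: "biquat \<Rightarrow> bool" where
  "divisor_of_zero q \<longleftrightarrow> q \<noteq> 0 \<and> semi_norm q = 0"

definition idempotent :: "biquat \<Rightarrow> bool" where
  "idempotent q \<longleftrightarrow> q\<^sup>2 = q"

end

theory Submission
  imports Defs
begin

text \<open>
  Let \<open>W \<noteq> 0\<close> be the scalar part and \<open>v\<close> the pure part of \<open>p\<close>. Since \<open>v\<^sup>2 = W\<^sup>2 - \<parallel>p\<parallel>\<close> and \<open>\<parallel>p\<parallel> = 0\<close>,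
  the pure biquaternion \<open>\<xi> = - v I / W\<close> is a square root of \<open>- 1\<close>, and
  \<open>p = W + v = 2 W (1/2 + 1/2 \<xi> I)\<close>.
\<close>

lemmas biquat_component_defs =
  biquat_of_complex_def zero_biquat_def one_biquat_def plus_biquat_def minus_biquat_def
  uminus_biquat_def times_biquat_def

text \<open>Complex scalars are central, so \<open>u = \<xi> * biquat_of_complex \<i>\<close>
  satisfies \<open>u * u = 1\<close>. Hence \<open>1 + u\<close> squares to twice itself, and
  halving it gives an idempotent.\<close>

lemma idempotent_half_plus_root:
  assumes "\<xi>\<^sup>2 = - 1"
  shows "idempotent (biquat_of_complex (1/2) + biquat_of_complex (1/2) * \<xi> * biquat_of_complex \<i>)"
proof -
  define u where "u = \<xi> * biquat_of_complex \<i>"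
  define h where "h = biquat_of_complex (1/2)"
  have "u * u = (\<xi> * \<xi>) * (biquat_of_complex \<i> * biquat_of_complex \<i>)"
    unfolding u_def by (metis biquat_of_complex_commute mult.assoc)
  also have "\<dots> = 1"
    using assms by (simp add: power2_eq_square biquat_component_defs)
  finally have u: "u * u = 1" .
  have h: "h + h = 1"
    by (simp add: h_def biquat_component_defs)
  have "(h + h * u) * (h + h * u) = h * h * (1 + u) * (1 + u)"
    by (metis biquat_of_complex_commute distrib_left h_def mult.assoc mult.right_neutral)
  also have "\<dots> = h * h * ((1 + u) + (1 + u))"
    by (simp add: algebra_simps u)
  also have "\<dots> = h * ((h + h) * (1 + u))"
    by (simp add: algebra_simps)
  also have "\<dots> = h + h * u"
    by (simp add: h distrib_left)
  finally show ?thesis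
    by (simp add: idempotent_def power2_eq_square u_def h_def mult.assoc)
qed

theorem theorem3:
  fixes p :: biquat
  assumes "divisor_of_zero p"
    and "\<not> pure p"
  shows "\<exists>(\<alpha>::complex) (q::biquat) (\<xi>::biquat).
           \<alpha> \<noteq> 0 \<and> p = biquat_of_complex \<alpha> * q \<and> idempotent q \<and> \<xi>\<^sup>2 = - 1 \<and>
           (q = biquat_of_complex (1/2) + biquat_of_complex (1/2) * \<xi> * biquat_of_complex \<i> \<or>
            q = biquat_of_complex (1/2) - biquat_of_complex (1/2) * \<xi> * biquat_of_complex \<i>)"
proof -
  obtain W X Y Z where p: "p = Biquat W X Y Z"
    by (cases p)
  have W: "W \<noteq> 0"
    using assms(2) by (simp add: p pure_def)
  have "W\<^sup>2 + X\<^sup>2 + Y\<^sup>2 + Z\<^sup>2 = 0"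
    using assms(1) by (simp add: p divisor_of_zero_def semi_norm_def)
  then have norm: "X\<^sup>2 + Y\<^sup>2 + Z\<^sup>2 = - W\<^sup>2"
    by (simp add: algebra_simps eq_neg_iff_add_eq_0)
  \<comment> \<open>In the coordinates of \<open>2 * W * q\<close>, one \<open>\<i>\<close> comes
    from \<open>\<xi>\<close> and the other from the right factor of \<open>q\<close>.\<close>
  have i_conj: "\<i> * c * \<i> = - c" for c
    by (metis i_squared mult.assoc mult.commute mult_minus1)
  define \<xi> where "\<xi> = Biquat 0 (- \<i> * X / W) (- \<i> * Y / W) (- \<i> * Z / W)"
  define q where
    "q = biquat_of_complex (1/2) + biquat_of_complex (1/2) * \<xi> * biquat_of_complex \<i>"
  \<comment> \<open>The left side is the scalar part of \<open>\<xi>\<^sup>2\<close>; the other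
    parts cancel because \<open>\<xi>\<close> is pure.\<close>
  have "X * X / (W * W) + Y * Y / (W * W) + Z * Z / (W * W) = - 1"
    using norm W by (simp add: power2_eq_square flip: add_divide_distrib)
  then have "\<xi>\<^sup>2 = - 1"
    by (simp add: \<xi>_def power2_eq_square biquat_component_defs algebra_simps)
  moreover from this have "idempotent q"
    unfolding q_def by (rule idempotent_half_plus_root)
  moreover have "p = biquat_of_complex (2 * W) * q"
    using W by (simp add: p q_def \<xi>_def biquat_component_defs i_conj)
  moreover have "2 * W \<noteq> 0"
    using W by simp
  ultimately show ?thesis
    using q_def by blast
qed

end
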